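(* The generating function $B(x)=\sum_{n\geq0}a_n(312,4321:321)x^n$ is given by \[B(x)=\frac{1-x}{1-2x-x^3+x^5}.\]
   Context: $\mathcal{S}_n$ is the set of permutations of $\{1,\ldots,n\}$ in one-line form; $\pi^2=\pi\circ\pi$. A permutation contains a pattern $\sigma\in\mathcal{S}_k$ if some subsequence of it (not necessarily consecutive) has the same relative order as $\sigma$; otherwise it avoids $\sigma$. $a_n(312,4321:\sigma)$ is the number of $\pi\in\mathcal{S}_n$ such that $\pi$ avoids both $312$ and $4321$ and $\pi^2$ avoids $\sigma$; $\mathcal{S}_0$ consists of the empty permutation, so $a_0=1$. The identity is one of formal power series. *)

theory Defs
  imports
    "HOL-Combinatorics.Permutations"
    "HOL-Library.Sublist"
    "HOL-Computational_Algebra.Formal_Power_Series"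
begin

text \<open>
  The members of $S_n$ are the functions \<open>p\<close> with \<open>p permutes {1..n}\<close>; patterns are
  given directly by their one-line forms, as lists.
\<close>

definition one_line :: "nat \<Rightarrow> (nat \<Rightarrow> nat) \<Rightarrow> nat list" where
  "one_line n p = map p [1..<Suc n]"

definition same_relative_order :: "nat list \<Rightarrow> nat list \<Rightarrow> bool" where
  "same_relative_order u v \<longleftrightarrow>
     length u = length v \<and>
     (\<forall>i < length u. \<forall>j < length u. u ! i < u ! j \<longleftrightarrow> v ! i < v ! j)"

definition contains_pattern :: "nat list \<Rightarrow> nat list \<Rightarrow> bool" where
  "contains_pattern w \<sigma> \<longleftrightarrow> (\<exists>u. subseq u w \<and> same_relative_order u \<sigma>)"

abbreviation avoids_pattern :: "nat list \<Rightarrow> nat list \<Rightarrow> bool" where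
  "avoids_pattern w \<sigma> \<equiv> \<not> contains_pattern w \<sigma>"

text \<open>
  \<open>avoid_count n T \<sigma>\<close> is $a_n(T : \sigma)$, where \<open>T\<close> is the set of patterns that the
  permutation itself has to avoid and \<open>\<sigma>\<close> is the pattern that its square has to avoid.
\<close>

definition avoid_count :: "nat \<Rightarrow> nat list set \<Rightarrow> nat list \<Rightarrow> nat" where
  "avoid_count n T \<sigma> =
     card {p. p permutes {1..n} \<and>
              (\<forall>\<tau>\<in>T. avoids_pattern (one_line n p) \<tau>) \<and>
              avoids_pattern (one_line n (p \<circ> p)) \<sigma>}"

end

theory Submission
  imports Defs
begin

text \<open>
  Write \<open>p\<close> as a direct sum according to the position \<open>k\<close> of the value \<open>1\<close>.  If \<open>p\<close> avoids
  312, every value before position \<open>k\<close> lies below every value after it, as otherwise \<open>1\<close> would be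
  the smallest letter of a 312.  So \<open>p\<close> maps \<open>{1..k}\<close> to itself and is the direct sum of
  a permutation of length \<open>k\<close> that ends in \<open>1\<close> and an arbitrary permutation of length \<open>n - k\<close>.
  Squaring respects direct sums.  Each of the patterns 312, 4321 and 321 starts
  with its largest letter, so an occurrence that begins in the first summand can never reach the
  second one; hence a direct sum satisfies the three avoidance conditions iff both summands do.
  If \<open>A(x)\<close> counts the permutations in question and \<open>I(x)\<close> those among them that end in \<open>1\<close>
  (the possible first summands, here called good blocks), then
  \<open>A = 1 + I A\<close> (\<open>fps_good_perms_eq\<close>).

  What remains is to list the good blocks (\<open>good_blocks_eq\<close>).  To the right of a
  position \<open>i < n\<close> at most one value besides the final \<open>1\<close> is smaller than \<open>p i\<close>: two such values
  give a 312 if they increase, and a 4321 together with the final \<open>1\<close> if they decrease.  Hence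
  \<open>p i \<le> i + 2\<close> (\<open>good_block_le_add_2\<close>).  So, for \<open>n \<ge> 2\<close>, \<open>n\<close> sits at position \<open>n - 1\<close> or \<open>n - 2\<close>, and \<open>p 1\<close> is \<open>2\<close> or \<open>3\<close>.  The square takes the
  value \<open>1\<close> at the position of \<open>n\<close>, so it increases to the left of that position.  This
  almost determines the square, and then \<open>p\<close> must be the cycle \<open>2 3 \<dots> n 1\<close>, except for the two
  sporadic blocks \<open>3 2 1\<close> and \<open>3 4 2 1\<close>.  Therefore
  \<open>I(x) = x / (1 - x) + x^3 + x^4\<close>, and \<open>A = 1 / (1 - I)\<close> is the claimed fraction.
\<close>

section \<open>Occurrences of a pattern as increasing lists of positions\<close>

lemma subseq_map_right_iff:
  "subseq u (map f xs) \<longleftrightarrow> (\<exists>zs. subseq zs xs \<and> u = map f zs)"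
  by (auto simp: subseq_conv_nths nths_map subseq_map)

lemma subseq_upt_iff:
  "subseq zs [a..<b] \<longleftrightarrow> sorted_wrt (<) zs \<and> set zs \<subseteq> {a..<b}"
proof
  assume "subseq zs [a..<b]"
  then obtain N where "zs = nths [a..<b] N"
    by (auto simp: subseq_conv_nths)
  then show "sorted_wrt (<) zs \<and> set zs \<subseteq> {a..<b}"
    using set_nths_subset[of "[a..<b]" N]
    by (auto simp: strict_sorted_iff sorted_nths distinct_nthsI)
next
  assume "sorted_wrt (<) zs \<and> set zs \<subseteq> {a..<b}"
  then show "subseq zs [a..<b]"
    by (intro sorted_subset_imp_subseq) (auto simp: strict_sorted_iff)
qed

text \<open>
  An occurrence is recorded by its positions rather than by its letters, so that it can be moved
  between a permutation and its direct summands.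
\<close>

lemma contains_one_line_iff:
  "contains_pattern (one_line n p) \<sigma> \<longleftrightarrow>
     (\<exists>zs. sorted_wrt (<) zs \<and> set zs \<subseteq> {1..n} \<and> same_relative_order (map p zs) \<sigma>)"
  unfolding contains_pattern_def one_line_def subseq_map_right_iff subseq_upt_iff
    atLeastLessThanSuc_atLeastAtMost
  by blast

lemma contains_length_3_iff:
  "contains_pattern (one_line n p) [a, b, c] \<longleftrightarrow>
     (\<exists>i j k. 1 \<le> i \<and> i < j \<and> j < k \<and> k \<le> n \<and>
        same_relative_order [p i, p j, p k] [a, b, c])"
  (is "_ \<longleftrightarrow> ?R")
proof
  assume "contains_pattern (one_line n p) [a, b, c]"
  then obtain zs where zs: "sorted_wrt (<) zs" "set zs \<subseteq> {1..n}"
    "same_relative_order (map p zs) [a, b, c]"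
    by (auto simp: contains_one_line_iff)
  then have "length zs = Suc (Suc (Suc 0))"
    by (simp add: same_relative_order_def)
  then obtain i j k where "zs = [i, j, k]"
    by (auto simp: length_Suc_conv)
  with zs show ?R by auto
next
  assume ?R
  then obtain i j k where "1 \<le> i" "i < j" "j < k" "k \<le> n"
    "same_relative_order [p i, p j, p k] [a, b, c]"
    by blast
  then show "contains_pattern (one_line n p) [a, b, c]"
    unfolding contains_one_line_iff by (intro exI[of _ "[i, j, k]"]) auto
qed

lemma contains_length_4_iff:
  "contains_pattern (one_line n p) [a, b, c, d] \<longleftrightarrow>
     (\<exists>i j k l. 1 \<le> i \<and> i < j \<and> j < k \<and> k < l \<and> l \<le> n \<and>
        same_relative_order [p i, p j, p k, p l] [a, b, c, d])"
  (is "_ \<longleftrightarrow> ?R")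
proof
  assume "contains_pattern (one_line n p) [a, b, c, d]"
  then obtain zs where zs: "sorted_wrt (<) zs" "set zs \<subseteq> {1..n}"
    "same_relative_order (map p zs) [a, b, c, d]"
    by (auto simp: contains_one_line_iff)
  then have "length zs = Suc (Suc (Suc (Suc 0)))"
    by (simp add: same_relative_order_def)
  then obtain i j k l where "zs = [i, j, k, l]"
    by (auto simp: length_Suc_conv)
  with zs show ?R by auto
next
  assume ?R
  then obtain i j k l where "1 \<le> i" "i < j" "j < k" "k < l" "l \<le> n"
    "same_relative_order [p i, p j, p k, p l] [a, b, c, d]"
    by blast
  then show "contains_pattern (one_line n p) [a, b, c, d]"
    unfolding contains_one_line_iff by (intro exI[of _ "[i, j, k, l]"]) auto
qed

lemma contains_312_iff:
  "contains_pattern (one_line n p) [3,1,2] \<longleftrightarrow>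
     (\<exists>i j k. 1 \<le> i \<and> i < j \<and> j < k \<and> k \<le> n \<and> p j < p k \<and> p k < p i)"
proof -
  have "same_relative_order [x, y, z] [3,1,2] \<longleftrightarrow> y < z \<and> z < x" for x y z
    by (auto simp: same_relative_order_def All_less_Suc)
  then show ?thesis by (simp add: contains_length_3_iff)
qed

lemma contains_321_iff:
  "contains_pattern (one_line n p) [3,2,1] \<longleftrightarrow>
     (\<exists>i j k. 1 \<le> i \<and> i < j \<and> j < k \<and> k \<le> n \<and> p k < p j \<and> p j < p i)"
proof -
  have "same_relative_order [x, y, z] [3,2,1] \<longleftrightarrow> z < y \<and> y < x" for x y z
    by (auto simp: same_relative_order_def All_less_Suc)
  then show ?thesis by (simp add: contains_length_3_iff)
qed

lemma contains_4321_iff: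
  "contains_pattern (one_line n p) [4,3,2,1] \<longleftrightarrow>
     (\<exists>i j k l. 1 \<le> i \<and> i < j \<and> j < k \<and> k < l \<and> l \<le> n \<and>
        p l < p k \<and> p k < p j \<and> p j < p i)"
proof -
  have "same_relative_order [w, x, y, z] [4,3,2,1] \<longleftrightarrow> z < y \<and> y < x \<and> x < w" for w x y z
    by (auto simp: same_relative_order_def All_less_Suc)
  then show ?thesis by (simp add: contains_length_4_iff)
qed

section \<open>Direct sums\<close>

definition direct_sum :: "nat \<Rightarrow> (nat \<Rightarrow> nat) \<Rightarrow> (nat \<Rightarrow> nat) \<Rightarrow> nat \<Rightarrow> nat" where
  "direct_sum k f g i = (if i \<le> k then f i else g (i - k) + k)"

lemma permutes_le: "f permutes {1..k} \<Longrightarrow> i \<le> k \<Longrightarrow> f i \<le> k" for k :: nat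
  using permutes_in_image[of f "{1..k}" i] permutes_not_in[of f "{1..k}" i]
  by (cases "i \<in> {1..k}") auto

lemma permutes_pos: "f permutes {1..k} \<Longrightarrow> 0 < i \<Longrightarrow> 0 < f i" for k :: nat
  using permutes_in_image[of f "{1..k}" i] permutes_not_in[of f "{1..k}" i]
  by (cases "i \<in> {1..k}") auto

lemma direct_sum_permutes:
  assumes f: "f permutes {1..k}" and g: "g permutes {1..m}"
  shows "direct_sum k f g permutes {1..k + m}"
proof (rule bij_imp_permutes)
  have "inj_on (direct_sum k f g) {1..k + m}"
  proof (rule inj_onI)
    fix i j assume "i \<in> {1..k + m}" "j \<in> {1..k + m}"
      and "direct_sum k f g i = direct_sum k f g j"
    then show "i = j"
      using permutes_le[OF f, of i] permutes_le[OF f, of j]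
        permutes_pos[OF g, of "i - k"] permutes_pos[OF g, of "j - k"]
        injD[OF permutes_inj[OF f], of i j] injD[OF permutes_inj[OF g], of "i - k" "j - k"]
      by (auto simp: direct_sum_def split: if_splits)
  qed
  moreover have "direct_sum k f g ` {1..k + m} \<subseteq> {1..k + m}"
  proof
    fix y assume "y \<in> direct_sum k f g ` {1..k + m}"
    then obtain i where "i \<in> {1..k + m}" "y = direct_sum k f g i" by blast
    then show "y \<in> {1..k + m}"
      using permutes_le[OF f, of i] permutes_le[OF g, of "i - k"]
        permutes_pos[OF f, of i] permutes_pos[OF g, of "i - k"]
      by (auto simp: direct_sum_def split: if_splits)
  qed
  ultimately show "bij_betw (direct_sum k f g) {1..k + m} {1..k + m}"
    by (simp add: bij_betw_def endo_inj_surj)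
next
  fix x assume "x \<notin> {1..k + m}"
  then have "x \<le> k \<longrightarrow> x \<notin> {1..k}" "x = 0 \<or> m < x - k" by auto
  then show "direct_sum k f g x = x"
    using permutes_not_in[OF f, of x] permutes_not_in[OF g, of "x - k"]
    by (auto simp: direct_sum_def)
qed

lemma direct_sum_comp:
  assumes f: "f permutes {1..k}" and g: "g permutes {1..m}"
  shows "direct_sum k f g \<circ> direct_sum k f g = direct_sum k (f \<circ> f) (g \<circ> g)"
proof
  fix i
  show "(direct_sum k f g \<circ> direct_sum k f g) i = direct_sum k (f \<circ> f) (g \<circ> g) i"
    using permutes_le[OF f, of i] permutes_pos[OF g, of "i - k"]
    by (auto simp: direct_sum_def)
qed

text \<open>
  The first letter of an occurrence is its largest.  If it lies in the first summand, where the
  values are at most \<open>k\<close>, the remaining letters are smaller still and stay there as well; if it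
  lies in the second summand, the remaining letters, being further right, do too.
\<close>

lemma contains_direct_sum_iff:
  assumes f: "f permutes {1..k}" and g: "g permutes {1..m}"
    and ne: "\<sigma> \<noteq> []" and max: "\<And>j. 0 < j \<Longrightarrow> j < length \<sigma> \<Longrightarrow> \<sigma> ! j < \<sigma> ! 0"
  shows "contains_pattern (one_line (k + m) (direct_sum k f g)) \<sigma> \<longleftrightarrow>
         contains_pattern (one_line k f) \<sigma> \<or> contains_pattern (one_line m g) \<sigma>"
  (is "?L \<longleftrightarrow> ?F \<or> ?G")
proof
  let ?p = "direct_sum k f g"
  assume ?L
  then obtain zs where zs: "sorted_wrt (<) zs" "set zs \<subseteq> {1..k + m}"
    "same_relative_order (map ?p zs) \<sigma>"
    by (auto simp: contains_one_line_iff)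
  then have len: "length zs = length \<sigma>" and "zs \<noteq> []"
    using ne by (auto simp: same_relative_order_def)
  have below: "?p (zs ! j) < ?p (zs ! 0)" if "0 < j" "j < length zs" for j
  proof -
    have "0 < length zs" using that by linarith
    then show ?thesis
      using zs(3) max[of j] that len unfolding same_relative_order_def
      by (metis length_map nth_map)
  qed
  show "?F \<or> ?G"
  proof (cases "zs ! 0 \<le> k")
    case True
    have le: "zs ! j \<le> k" if "j < length zs" for j
    proof (cases "j = 0")
      case False
      then show ?thesis
        using below[of j] that True permutes_le[OF f, of "zs ! 0"]
        by (auto simp: direct_sum_def split: if_splits)
    qed (use True in simp)
    then have sub: "set zs \<subseteq> {1..k}"
      using zs(2) by (force simp: in_set_conv_nth)
    then have "map ?p zs = map f zs"
      by (auto simp: direct_sum_def)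
    with zs sub show ?thesis
      by (auto simp: contains_one_line_iff)
  next
    case False
    have gt: "k < zs ! j" if "j < length zs" for j
      using sorted_wrt_nth_less[OF zs(1), of 0 j] that False by (cases "j = 0") auto
    define ws where "ws = map (\<lambda>i. i - k) zs"
    have "sorted_wrt (<) ws"
      using zs(1) gt by (auto simp: ws_def sorted_wrt_iff_nth_less diff_less_mono less_imp_le)
    moreover have "set ws \<subseteq> {1..m}"
      using zs(2) gt by (force simp: ws_def in_set_conv_nth subset_iff)
    moreover have "same_relative_order (map g ws) \<sigma>"
      using zs(3) gt
      by (auto simp: same_relative_order_def ws_def direct_sum_def not_le[symmetric])
    ultimately show ?thesis
      by (auto simp: contains_one_line_iff)
  qed
next
  let ?p = "direct_sum k f g"
  assume "?F \<or> ?G"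
  then show ?L
  proof
    assume ?F
    then obtain zs where zs: "sorted_wrt (<) zs" "set zs \<subseteq> {1..k}"
      "same_relative_order (map f zs) \<sigma>"
      by (auto simp: contains_one_line_iff)
    have "map ?p zs = map f zs"
      using zs(2) by (auto simp: direct_sum_def)
    then have "same_relative_order (map ?p zs) \<sigma>"
      using zs(3) by (simp only:)
    moreover have "set zs \<subseteq> {1..k + m}" using zs(2) by auto
    ultimately show ?L
      unfolding contains_one_line_iff using zs(1) by blast
  next
    assume ?G
    then obtain zs where zs: "sorted_wrt (<) zs" "set zs \<subseteq> {1..m}"
      "same_relative_order (map g zs) \<sigma>"
      by (auto simp: contains_one_line_iff)
    have "map ?p (map (\<lambda>i. i + k) zs) = map (\<lambda>i. g i + k) zs"
      using zs(2) by (auto simp: direct_sum_def)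
    then have "same_relative_order (map ?p (map (\<lambda>i. i + k) zs)) \<sigma>"
      using zs(3) by (simp add: same_relative_order_def)
    moreover have "sorted_wrt (<) (map (\<lambda>i. i + k) zs)"
      using zs(1) by (simp add: sorted_wrt_map)
    ultimately show ?L
      unfolding contains_one_line_iff using zs(2)
      by (intro exI[of _ "map (\<lambda>i. i + k) zs"]) auto
  qed
qed

section \<open>Splitting off the first summand\<close>

definition good_perms :: "nat \<Rightarrow> (nat \<Rightarrow> nat) set" where
  "good_perms n = {p. p permutes {1..n} \<and>
     avoids_pattern (one_line n p) [3,1,2] \<and> avoids_pattern (one_line n p) [4,3,2,1] \<and>
     avoids_pattern (one_line n (p \<circ> p)) [3,2,1]}"

text \<open>
  The good permutations that cannot be split as a direct sum: the first summand of a
  312-avoiding permutation ends at the value \<open>1\<close>, so ending in \<open>1\<close> expresses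
  indecomposability.
\<close>

definition good_blocks :: "nat \<Rightarrow> (nat \<Rightarrow> nat) set" where
  "good_blocks n = {p \<in> good_perms n. 1 \<le> n \<and> p n = 1}"

lemma avoid_count_eq_card: "avoid_count n {[3,1,2], [4,3,2,1]} [3,2,1] = card (good_perms n)"
  by (simp add: avoid_count_def good_perms_def)

lemma finite_good_perms: "finite (good_perms n)"
  by (rule finite_subset[OF _ finite_permutations[of "{1..n}"]]) (auto simp: good_perms_def)

lemma finite_good_blocks: "finite (good_blocks n)"
  using finite_good_perms[of n] by (simp add: good_blocks_def)

lemma direct_sum_good_iff:
  assumes f: "f permutes {1..k}" and g: "g permutes {1..m}"
  shows "direct_sum k f g \<in> good_perms (k + m) \<longleftrightarrow> f \<in> good_perms k \<and> g \<in> good_perms m"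
proof -
  note ff = permutes_compose[OF f f] and gg = permutes_compose[OF g g]
  have "contains_pattern (one_line (k + m) (direct_sum k f g)) [3,1,2] \<longleftrightarrow>
      contains_pattern (one_line k f) [3,1,2] \<or> contains_pattern (one_line m g) [3,1,2]"
    by (rule contains_direct_sum_iff[OF f g]) (auto simp: less_Suc_eq numeral_eq_Suc)
  moreover have "contains_pattern (one_line (k + m) (direct_sum k f g)) [4,3,2,1] \<longleftrightarrow>
      contains_pattern (one_line k f) [4,3,2,1] \<or> contains_pattern (one_line m g) [4,3,2,1]"
    by (rule contains_direct_sum_iff[OF f g]) (auto simp: less_Suc_eq numeral_eq_Suc)
  moreover have "contains_pattern (one_line (k + m) (direct_sum k (f \<circ> f) (g \<circ> g))) [3,2,1] \<longleftrightarrow>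
      contains_pattern (one_line k (f \<circ> f)) [3,2,1] \<or> contains_pattern (one_line m (g \<circ> g)) [3,2,1]"
    by (rule contains_direct_sum_iff[OF ff gg]) (auto simp: less_Suc_eq numeral_eq_Suc)
  ultimately show ?thesis
    using f g direct_sum_permutes[OF f g] by (auto simp: good_perms_def direct_sum_comp[OF f g])
qed

text \<open>
  For \<open>i < k < j\<close> the values satisfy \<open>p i < p j\<close>, since otherwise the positions \<open>i\<close>, \<open>k\<close>, \<open>j\<close>
  form a 312 with smallest letter \<open>p k = 1\<close>.  Hence the \<open>n - k\<close> values after position \<open>k\<close> all lie above \<open>p i\<close>, which forces
  \<open>p i \<le> k\<close>.
\<close>

lemma permutes_prefix:
  assumes p: "p permutes {1..n}" and k: "1 \<le> k" "k \<le> n" "p k = 1"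
    and av: "avoids_pattern (one_line n p) [3,1,2]"
  shows "p ` {1..k} = {1..k}"
proof -
  have inj: "inj p" using p by (rule permutes_inj)
  have lt: "p i < p j" if "1 \<le> i" "i \<le> k" "k < j" "j \<le> n" for i j
  proof (rule ccontr)
    assume "\<not> p i < p j"
    then have "p j < p i" using injD[OF inj, of i j] that by force
    moreover have "1 < p j"
      using permutes_pos[OF p, of j] injD[OF inj, of j k] that k by force
    ultimately have "i < k" using that k by (cases "i = k") auto
    with \<open>p j < p i\<close> \<open>1 < p j\<close> that k av show False
      unfolding contains_312_iff by metis
  qed
  have "p i \<le> k" if i: "1 \<le> i" "i \<le> k" for i
  proof -
    have "p ` {k<..n} \<subseteq> {p i<..n}"
      using lt[OF i] permutes_le[OF p] by auto
    then have "card (p ` {k<..n}) \<le> card {p i<..n}"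
      by (intro card_mono) auto
    moreover have "card (p ` {k<..n}) = n - k"
      using inj by (subst card_image) (auto intro: inj_on_subset)
    ultimately have "n - k \<le> n - p i" by simp
    then show ?thesis
      using k permutes_le[OF p, of i] i by linarith
  qed
  then have "p ` {1..k} \<subseteq> {1..k}"
    using permutes_pos[OF p] by (auto simp: Suc_le_eq)
  then show ?thesis
    using inj by (intro endo_inj_surj) (auto intro: inj_on_subset)
qed

lemma split_direct_sum:
  assumes p: "p permutes {1..k + m}" and pk: "p ` {1..k} = {1..k}"
  obtains f g where "f permutes {1..k}" "g permutes {1..m}" "p = direct_sum k f g"
proof -
  have inj: "inj p" using p by (rule permutes_inj)
  define f where "f i = (if i \<in> {1..k} then p i else i)" for i
  define g where "g i = (if i \<in> {1..m} then p (i + k) - k else i)" for i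
  have gt: "k < p (i + k)" "p (i + k) \<le> k + m" if "i \<in> {1..m}" for i
  proof -
    have "p (i + k) \<notin> p ` {1..k}"
      using that by (simp add: inj_image_mem_iff[OF inj])
    then show "k < p (i + k)" "p (i + k) \<le> k + m"
      using that pk permutes_pos[OF p, of "i + k"] permutes_le[OF p, of "i + k"] by auto
  qed
  have "f permutes {1..k}"
  proof (rule bij_imp_permutes)
    have "bij_betw p {1..k} {1..k}"
      using inj pk by (auto simp: bij_betw_def intro: inj_on_subset)
    then show "bij_betw f {1..k} {1..k}"
      by (rule bij_betw_cong[THEN iffD1, rotated]) (auto simp: f_def)
  qed (auto simp: f_def)
  moreover have "g permutes {1..m}"
  proof (rule bij_imp_permutes)
    have "inj_on g {1..m}"
    proof (rule inj_onI)
      fix i j assume ij: "i \<in> {1..m}" "j \<in> {1..m}" "g i = g j"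
      then have "p (i + k) = p (j + k)"
        using gt[of i] gt[of j] by (auto simp: g_def)
      then show "i = j" using injD[OF inj] by fastforce
    qed
    moreover have "g ` {1..m} \<subseteq> {1..m}"
      using gt by (force simp: g_def)
    ultimately show "bij_betw g {1..m} {1..m}"
      by (simp add: bij_betw_def endo_inj_surj)
  qed (auto simp: g_def)
  moreover have "p = direct_sum k f g"
  proof
    fix i
    show "p i = direct_sum k f g i"
      using gt[of "i - k"] permutes_not_in[OF p, of i]
      by (cases "i \<in> {1..k}"; cases "i \<in> {k<..k+m}")
        (auto simp: direct_sum_def f_def g_def Suc_le_eq)
  qed
  ultimately show ?thesis using that by blast
qed

lemma direct_sum_inject:
  assumes f: "f permutes {1..k}" "f' permutes {1..k}"
    and g: "g permutes {1..m}" "g' permutes {1..m}"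
    and eq: "direct_sum k f g = direct_sum k f' g'"
  shows "f = f' \<and> g = g'"
proof
  show "f = f'"
  proof
    fix i
    show "f i = f' i"
      using fun_cong[OF eq, of i] permutes_not_in[OF f(1), of i] permutes_not_in[OF f(2), of i]
      by (cases "i \<le> k") (auto simp: direct_sum_def)
  qed
  show "g = g'"
  proof
    fix i
    show "g i = g' i"
      using fun_cong[OF eq, of "i + k"] permutes_not_in[OF g(1), of i] permutes_not_in[OF g(2), of i]
      by (cases "i = 0") (auto simp: direct_sum_def)
  qed
qed

lemma good_perms_first_block:
  assumes "1 \<le> k" "k \<le> n"
  shows "{p \<in> good_perms n. p k = 1} =
         (\<lambda>(f, g). direct_sum k f g) ` (good_blocks k \<times> good_perms (n - k))"
    (is "?L = ?R")
proof
  show "?L \<subseteq> ?R"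
  proof
    fix p assume "p \<in> ?L"
    then have p: "p permutes {1..n}" "avoids_pattern (one_line n p) [3,1,2]" "p k = 1"
      and good: "p \<in> good_perms n"
      by (auto simp: good_perms_def)
    have "p permutes {1..k + (n - k)}" using p(1) assms by simp
    then obtain f g where fg: "f permutes {1..k}" "g permutes {1..n - k}" "p = direct_sum k f g"
      using permutes_prefix[OF p(1) assms p(3,2)] by (rule split_direct_sum)
    with good have "f \<in> good_perms k \<and> g \<in> good_perms (n - k)"
      using direct_sum_good_iff[OF fg(1,2)] assms by simp
    moreover have "f k = 1"
      using p(3) fg(3) by (simp add: direct_sum_def)
    ultimately show "p \<in> ?R"
      using fg(3) assms by (auto simp: good_blocks_def)
  qed
next
  show "?R \<subseteq> ?L"
  proof
    fix p assume "p \<in> ?R"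
    then obtain f g where fg: "f \<in> good_blocks k" "g \<in> good_perms (n - k)" "p = direct_sum k f g"
      by auto
    then have "f permutes {1..k}" "g permutes {1..n - k}" "f \<in> good_perms k" "f k = 1"
      by (auto simp: good_blocks_def good_perms_def)
    then show "p \<in> ?L"
      using fg direct_sum_good_iff[of f k g "n - k"] assms by (auto simp: direct_sum_def)
  qed
qed

text \<open>
  Sorting by the position \<open>k\<close> of the value \<open>1\<close>, which is the length of the first summand.
\<close>

lemma card_good_perms_rec:
  assumes "1 \<le> n"
  shows "card (good_perms n) = (\<Sum>k=1..n. card (good_blocks k) * card (good_perms (n - k)))"
proof -
  have "good_perms n = (\<Union>k\<in>{1..n}. {p \<in> good_perms n. p k = 1})"
  proof (intro subset_antisym subsetI)
    fix p assume p: "p \<in> good_perms n"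
    then have "p ` {1..n} = {1..n}"
      by (auto simp: good_perms_def permutes_image)
    then have "1 \<in> p ` {1..n}" using assms by simp
    then obtain k where "k \<in> {1..n}" "p k = 1" by (metis imageE)
    with p show "p \<in> (\<Union>k\<in>{1..n}. {p \<in> good_perms n. p k = 1})" by blast
  qed auto
  then have "card (good_perms n) = card (\<Union>k\<in>{1..n}. {p \<in> good_perms n. p k = 1})"
    by simp
  also have "\<dots> = (\<Sum>k=1..n. card {p \<in> good_perms n. p k = 1})"
  proof (rule card_UN_disjoint)
    show "\<forall>k\<in>{1..n}. finite {p \<in> good_perms n. p k = 1}"
      using finite_good_perms by simp
    show "\<forall>i\<in>{1..n}. \<forall>j\<in>{1..n}. i \<noteq> j \<longrightarrow>
        {p \<in> good_perms n. p i = 1} \<inter> {p \<in> good_perms n. p j = 1} = {}"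
      by (auto simp: good_perms_def dest!: permutes_inj) (metis injD)
  qed simp
  also have "\<dots> = (\<Sum>k=1..n. card (good_blocks k) * card (good_perms (n - k)))"
  proof (rule sum.cong[OF refl])
    fix k assume k: "k \<in> {1..n}"
    have "inj_on (\<lambda>(f, g). direct_sum k f g) (good_blocks k \<times> good_perms (n - k))"
      by (rule inj_onI)
        (auto simp: good_blocks_def good_perms_def dest!: direct_sum_inject[rotated 4])
    then show "card {p \<in> good_perms n. p k = 1} =
        card (good_blocks k) * card (good_perms (n - k))"
      using k good_perms_first_block[of k n]
      by (simp add: card_image card_cartesian_product)
  qed
  finally show ?thesis .
qed

section \<open>The indecomposable summands\<close>

definition shift_cycle :: "nat \<Rightarrow> nat \<Rightarrow> nat" where
  "shift_cycle n i = (if 1 \<le> i \<and> i < n then i + 1 else if i = n then 1 else i)"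

definition perm_321 :: "nat \<Rightarrow> nat" where
  "perm_321 i = (if i = 1 then 3 else if i = 3 then 1 else i)"

definition perm_3421 :: "nat \<Rightarrow> nat" where
  "perm_3421 i = (if i = 1 then 3 else if i = 2 then 4 else if i = 3 then 2
     else if i = 4 then 1 else i)"

lemma permutes_if_image_eq:
  assumes "finite A" "p ` A = A" "\<And>x. x \<notin> A \<Longrightarrow> p x = x"
  shows "p permutes A"
  using assms by (intro bij_imp_permutes) (auto simp: bij_betw_def intro: eq_card_imp_inj_on)

lemma shift_cycle_permutes:
  assumes "1 \<le> n" shows "shift_cycle n permutes {1..n}"
proof (rule permutes_if_image_eq)
  show "shift_cycle n ` {1..n} = {1..n}"
  proof (intro subset_antisym subsetI)
    fix y assume "y \<in> {1..n}"
    then have "y = shift_cycle n (if y = 1 then n else y - 1)"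
      "(if y = 1 then n else y - 1) \<in> {1..n}"
      by (auto simp: shift_cycle_def)
    then show "y \<in> shift_cycle n ` {1..n}" by blast
  qed (auto simp: shift_cycle_def)
qed (use assms in \<open>auto simp: shift_cycle_def\<close>)

text \<open>
  In \<open>2 3 \<dots> n 1\<close> every descent ends at the last position, which excludes 312 and 4321.  The
  square \<open>3 4 \<dots> n 1 2\<close> is a concatenation of two increasing runs, which excludes 321.
\<close>

lemma shift_cycle_good_block:
  assumes n: "1 \<le> n" shows "shift_cycle n \<in> good_blocks n"
proof -
  have desc: "j = n" if "1 \<le> i" "i < j" "j \<le> n" "shift_cycle n j < shift_cycle n i" for i j
    using that by (auto simp: shift_cycle_def split: if_splits)
  have "avoids_pattern (one_line n (shift_cycle n)) [3,1,2]"
    unfolding contains_312_iff using desc by (metis less_trans less_imp_le nat_neq_iff not_le)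
  moreover have "avoids_pattern (one_line n (shift_cycle n)) [4,3,2,1]"
    unfolding contains_4321_iff using desc
    by (metis less_trans less_imp_le nat_neq_iff not_le)
  moreover have "avoids_pattern (one_line n (shift_cycle n \<circ> shift_cycle n)) [3,2,1]"
    unfolding contains_321_iff by (auto simp: shift_cycle_def split: if_splits)
  ultimately show ?thesis
    using shift_cycle_permutes[OF n] n
    by (simp add: good_blocks_def good_perms_def) (simp add: shift_cycle_def)
qed

lemma atLeastAtMost_1_3: "{1..3::nat} = {1, 2, 3}" and atLeastAtMost_1_4: "{1..4::nat} = {1, 2, 3, 4}"
  by auto

lemma perm_321_good_block: "perm_321 \<in> good_blocks 3"
proof -
  have idx: "i = 1 \<and> j = 2 \<and> k = 3" if "1 \<le> i" "i < j" "j < k" "k \<le> 3" for i j k :: nat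
    using that by linarith
  have "perm_321 permutes {1, 2, 3}"
    by (rule permutes_if_image_eq) (auto simp: perm_321_def)
  then have "perm_321 permutes {1..3}"
    by (simp only: atLeastAtMost_1_3)
  moreover have "avoids_pattern (one_line 3 perm_321) [3,1,2]"
    "avoids_pattern (one_line 3 (perm_321 \<circ> perm_321)) [3,2,1]"
    "avoids_pattern (one_line 3 perm_321) [4,3,2,1]"
    unfolding contains_312_iff contains_321_iff contains_4321_iff
    by (auto dest!: idx simp: perm_321_def)
  ultimately show ?thesis
    by (simp add: good_blocks_def good_perms_def) (simp add: perm_321_def)
qed

lemma perm_3421_good_block: "perm_3421 \<in> good_blocks 4"
proof -
  have idx: "i = 1 \<and> j = 2 \<and> k = 3 \<or> i = 1 \<and> j = 2 \<and> k = 4 \<or>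
      i = 1 \<and> j = 3 \<and> k = 4 \<or> i = 2 \<and> j = 3 \<and> k = 4"
    if "1 \<le> i" "i < j" "j < k" "k \<le> 4" for i j k :: nat
    using that by linarith
  have idx4: "i = 1 \<and> j = 2 \<and> k = 3 \<and> l = 4"
    if "1 \<le> i" "i < j" "j < k" "k < l" "l \<le> 4" for i j k l :: nat
    using that by linarith
  have "perm_3421 permutes {1, 2, 3, 4}"
    by (rule permutes_if_image_eq) (auto simp: perm_3421_def)
  then have "perm_3421 permutes {1..4}"
    by (simp only: atLeastAtMost_1_4)
  moreover have "avoids_pattern (one_line 4 perm_3421) [3,1,2]"
    "avoids_pattern (one_line 4 (perm_3421 \<circ> perm_3421)) [3,2,1]"
    unfolding contains_312_iff contains_321_iff
    by (auto dest!: idx simp: perm_3421_def)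
  moreover have "avoids_pattern (one_line 4 perm_3421) [4,3,2,1]"
    unfolding contains_4321_iff by (auto dest!: idx4 simp: perm_3421_def)
  ultimately show ?thesis
    by (simp add: good_blocks_def good_perms_def) (simp add: perm_3421_def)
qed

text \<open>
  Let \<open>S\<close> be the set of positions strictly between \<open>i\<close> and \<open>n\<close> with values below \<open>p i\<close>.  Two
  elements of \<open>S\<close> would form a 312 with \<open>i\<close> if their values increase, and a 4321 with
  \<open>i\<close> and the final \<open>1\<close> if they decrease.  The \<open>p i - 1\<close> values below \<open>p i\<close> are
  thus taken at the \<open>i - 1\<close> positions before \<open>i\<close>, at most one position in \<open>S\<close>, and \<open>n\<close>.
\<close>

lemma good_block_le_add_2:
  assumes p: "p \<in> good_blocks n" and i: "1 \<le> i" "i < n"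
  shows "p i \<le> i + 2"
proof -
  have perm: "p permutes {1..n}" and pn: "p n = 1"
    and av312: "avoids_pattern (one_line n p) [3,1,2]"
    and av4321: "avoids_pattern (one_line n p) [4,3,2,1]"
    using p by (auto simp: good_blocks_def good_perms_def)
  have inj: "inj p" using perm by (rule permutes_inj)
  have gt1: "1 < p j" if "1 \<le> j" "j < n" for j
    using permutes_pos[OF perm, of j] injD[OF inj, of j n] pn that by force
  define S where "S = {j. i < j \<and> j < n \<and> p j < p i}"
  have no2: False if "j \<in> S" "j' \<in> S" "j < j'" for j j'
  proof (cases "p j < p j'")
    case True
    with that av312 i show False
      unfolding contains_312_iff S_def by (auto dest: less_imp_le)
  next
    case False
    then have "p j' < p j" using injD[OF inj, of j j'] that by force
    moreover have "p n < p j'" using gt1[of j'] that i pn by (auto simp: S_def)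
    ultimately show False using that av4321 i
      unfolding contains_4321_iff S_def by blast
  qed
  have "finite S" by (rule finite_subset[of _ "{..<n}"]) (auto simp: S_def)
  then have "card S \<le> 1"
    using no2 by (metis card_le_Suc0_iff_eq One_nat_def nat_neq_iff)
  have "{1..<p i} \<subseteq> p ` ({1..<i} \<union> S \<union> {n})"
  proof
    fix y assume y: "y \<in> {1..<p i}"
    then have "y \<in> p ` {1..n}"
      using permutes_image[OF perm] permutes_le[OF perm, of i] i by auto
    then obtain j where "j \<in> {1..n}" "y = p j" by blast
    with y show "y \<in> p ` ({1..<i} \<union> S \<union> {n})"
      by (cases "j = n"; cases "j = i") (auto simp: S_def)
  qed
  then have "card {1..<p i} \<le> card (p ` ({1..<i} \<union> S \<union> {n}))"
    using \<open>finite S\<close> by (intro card_mono) auto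
  also have "\<dots> \<le> card ({1..<i} \<union> S \<union> {n})"
    using \<open>finite S\<close> by (intro card_image_le) auto
  also have "\<dots> \<le> card {1..<i} + card S + card {n}"
    by (meson add_le_mono1 card_Un_le le_trans)
  finally show ?thesis using \<open>card S \<le> 1\<close> i by simp
qed

text \<open>
  A strictly increasing map between integer intervals of equal length is a translation.  It
  recovers the square of a block from its monotonicity and the values that it omits.
\<close>

lemma strict_mono_on_interval_eq_add:
  fixes q :: "nat \<Rightarrow> nat"
  assumes mono: "\<And>i j. 1 \<le> i \<Longrightarrow> i < j \<Longrightarrow> j \<le> m \<Longrightarrow> q i < q j"
    and lo: "\<And>i. 1 \<le> i \<Longrightarrow> i \<le> m \<Longrightarrow> c < q i"
    and hi: "\<And>i. 1 \<le> i \<Longrightarrow> i \<le> m \<Longrightarrow> q i \<le> m + c"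
    and i: "1 \<le> i" "i \<le> m"
  shows "q i = i + c"
proof -
  have "i + c \<le> q i" using i
  proof (induction i rule: nat_induct_at_least)
    case base
    then show ?case using lo[of 1] by simp
  next
    case (Suc k)
    then show ?case using mono[of k "Suc k"] by simp
  qed
  moreover have "q i \<le> i + c" using i(2,1)
  proof (induction i rule: inc_induct)
    case base
    then show ?case using hi by simp
  next
    case (step k)
    then show ?case using mono[of k "Suc k"] by simp
  qed
  ultimately show ?thesis by simp
qed

lemma shift_cycle_eqI:
  assumes perm: "p permutes {1..n}" and "1 \<le> n" "p n = 1"
    and "\<And>i. 1 \<le> i \<Longrightarrow> i < n \<Longrightarrow> p i = i + 1"
  shows "p = shift_cycle n"
proof
  fix i show "p i = shift_cycle n i"
    using assms permutes_not_in[OF perm, of i] by (auto simp: shift_cycle_def)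
qed

text \<open>
  Recovers \<open>p\<close> from its square: if \<open>p k = k + 1\<close>, then \<open>p (k + 1) = p (p k) = k + 2\<close>.
\<close>

lemma successor_chain:
  fixes p :: "nat \<Rightarrow> nat"
  assumes "p 1 = 2" and sq: "\<And>i. 1 \<le> i \<Longrightarrow> i \<le> m \<Longrightarrow> p (p i) = i + 2"
    and i: "1 \<le> i" "i \<le> m + 1"
  shows "p i = i + 1"
  using i
proof (induction i rule: nat_induct_at_least)
  case (Suc k)
  then have "p k = k + 1" by simp
  then show ?case using sq[of k] Suc by simp
qed (use assms(1) in simp)

text \<open>
  Let \<open>n \<ge> 2\<close>, let \<open>a\<close> be the position of \<open>n\<close> and \<open>q\<close> the square of \<open>p\<close>.  Then
  \<open>q a = p n = 1\<close>, so \<open>q\<close> is increasing on \<open>{1..<a}\<close>, for a descent there would be completed to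
  a 321 by \<open>q a\<close>.  By the bound \<open>p i \<le> i + 2\<close>, at most two positions lie to the right of \<open>a\<close>, and
  \<open>q n = p 1\<close> is \<open>2\<close> or \<open>3\<close>.

  Suppose that \<open>a = n - 1\<close>, or that \<open>a = n - 2\<close> and \<open>n \<ge> 5\<close>.  If \<open>p 1 = 2\<close>, then \<open>q\<close> is the
  translation by \<open>2\<close> to the left of \<open>a\<close>, which makes \<open>p\<close> a successor chain up to position \<open>a\<close>; this
  yields the cycle if \<open>a = n - 1\<close> and contradicts \<open>p a = n\<close> if \<open>a = n - 2\<close>.  If \<open>p 1 = 3\<close>, the
  first few values of \<open>q\<close> are forced and make \<open>p\<close> or \<open>q\<close> take a value twice.

  If \<open>a = n - 2\<close> and \<open>n\<close> is \<open>3\<close> or \<open>4\<close>, the increasing part of \<open>q\<close> has at most one element, and the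
  values of \<open>p\<close> are found one by one; this is where the sporadic blocks arise.
\<close>

lemma good_block_cases:
  assumes p: "p \<in> good_blocks n"
  shows "p = shift_cycle n \<or> n = 3 \<and> p = perm_321 \<or> n = 4 \<and> p = perm_3421"
proof -
  have perm: "p permutes {1..n}" and pn: "p n = 1" and n1: "1 \<le> n"
    and av: "avoids_pattern (one_line n (p \<circ> p)) [3,2,1]"
    using p by (auto simp: good_blocks_def good_perms_def)
  note inj = permutes_inj[OF perm]
  define q where "q = p \<circ> p"
  have qperm: "q permutes {1..n}"
    unfolding q_def using perm perm by (rule permutes_compose)
  note qinj = permutes_inj[OF qperm]
  have q_eq: "q i = p (p i)" for i by (simp add: q_def)
  have qn: "q n = p 1" using pn by (simp add: q_eq)
  have no321: "\<not> (q k < q j \<and> q j < q i)" if "1 \<le> i" "i < j" "j < k" "k \<le> n" for i j k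
    using av that unfolding q_def contains_321_iff by blast
  have p_ne: "p i \<noteq> p j" if "i \<noteq> j" for i j using injD[OF inj] that by blast
  have q_ne: "q i \<noteq> q j" if "i \<noteq> j" for i j using injD[OF qinj] that by blast
  have p_ge2: "2 \<le> p i" if "1 \<le> i" "i < n" for i
    using permutes_pos[OF perm, of i] p_ne[of i n] pn that by force
  have p_le: "p i \<le> i + 2" "p i \<le> n" if "1 \<le> i" "i < n" for i
    using good_block_le_add_2[OF p that] permutes_le[OF perm, of i] that by auto
  have q_pos: "1 \<le> q i" if "1 \<le> i" for i
    using permutes_pos[OF qperm, of i] that by simp
  have q_le: "q i \<le> n" if "i \<le> n" for i
    using permutes_le[OF qperm, of i] that by simp
  have q_onto: "\<exists>i. 1 \<le> i \<and> i \<le> n \<and> q i = y" if "1 \<le> y" "y \<le> n" for y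
  proof -
    have "y \<in> q ` {1..n}" unfolding permutes_image[OF qperm] using that by simp
    then show ?thesis by auto
  qed
  show ?thesis
  proof (cases "n = 1")
    case True
    then show ?thesis using shift_cycle_eqI[OF perm n1 pn] by auto
  next
    case False
    then have n2: "2 \<le> n" using n1 by simp
    have "n \<in> p ` {1..n}" unfolding permutes_image[OF perm] using n1 by simp
    then obtain a where a: "1 \<le> a" "a \<le> n" "p a = n" by auto
    then have "a \<noteq> n" using pn n2 by auto
    with a have "a < n" "n \<le> a + 2" using p_le(1)[of a] by auto
    have incr: "q i < q j" if "1 \<le> i" "i < j" "j < a" for i j
    proof -
      have "q a = 1" using a pn by (simp add: q_eq)
      then have "q a < q j" using q_ne[of j a] q_pos[of j] that by force
      then show ?thesis
        using no321[of i j a] q_ne[of i j] that a by force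
    qed
    have qa: "q a = 1" using a pn by (simp add: q_eq)
    consider (A) "a = n - 1" | (B) "a = n - 2" "3 \<le> n"
      using \<open>a < n\<close> \<open>n \<le> a + 2\<close> a(1) by linarith
    then show ?thesis
    proof cases
      case A
      have p1: "p 1 = 2 \<or> p 1 = 3" using p_ge2[of 1] p_le(1)[of 1] n2 by auto
      then show ?thesis
      proof
        assume p1: "p 1 = 2"
        have sq: "q i = i + 2" if "1 \<le> i" "i \<le> n - 2" for i
        proof (rule strict_mono_on_interval_eq_add[OF _ _ _ that])
          fix i assume i: "1 \<le> i" "i \<le> n - 2"
          \<comment> \<open>The values 1 and 2 are used up by \<open>q a = 1\<close> and \<open>q n = p 1 = 2\<close>.\<close>
          show "2 < q i"
            using q_pos[OF i(1)] q_ne[of i n] q_ne[of i a] qn qa p1 i A n2 by force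
          show "q i \<le> n - 2 + 2" using q_le[of i] i n2 by linarith
        qed (use incr A in auto)
        have "p i = i + 1" if "1 \<le> i" "i < n" for i
          using successor_chain[of p "n - 2" i] sq p1 that by (auto simp: q_eq)
        then show ?thesis using shift_cycle_eqI[OF perm n1 pn] by blast
      next
        assume p1: "p 1 = 3"
        then have "n \<noteq> 2" "n \<noteq> 3" using A a p_le(2)[of 1] p_ne[of 1 2] by auto
        then have n4: "4 \<le> n" using n2 by linarith
        \<comment> \<open>With 1 and 3 taken at \<open>a\<close> and \<open>n\<close>, the increasing part of \<open>q\<close> starts with 2, 4;
          then \<open>p 3 = 2\<close>, so \<open>p 2 = 4\<close>, and \<open>q 2 = p 4\<close> repeats the value 4.\<close>
        obtain j where j: "1 \<le> j" "j \<le> n" "q j = 2" using q_onto[of 2] n4 by auto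
        then have "j < a" using qn qa p1 A by (cases "j = n"; cases "j = a") auto
        then have q1: "q 1 = 2"
          using incr[of 1 j] j q_pos[of 1] q_ne[of 1 a] qa by (cases "j = 1") auto
        obtain l where l: "1 \<le> l" "l \<le> n" "q l = 4" using q_onto[of 4] n4 by auto
        then have "l < a" using qn qa p1 A by (cases "l = n"; cases "l = a") auto
        then have "q 2 = 4"
          using incr[of 1 2] incr[of 2 l] l q1 q_ne[of 2 n] qn p1 n4
          by (cases "l = 1"; cases "l = 2") auto
        have "p 3 = 2" using q1 p1 by (simp add: q_eq)
        then have "p 2 = 4"
          using p_ge2[of 2] p_le(1)[of 2] p_ne[of 2 1] p_ne[of 2 3] p1 n4 by force
        then show ?thesis using \<open>q 2 = 4\<close> p_ne[of 2 4] by (simp add: q_eq)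
      qed
    next
      case B
      have p1: "p 1 = 2 \<or> p 1 = 3" using p_ge2[of 1] p_le(1)[of 1] n2 by auto
      consider "n = 3" | "n = 4" | "5 \<le> n" using B by linarith
      then show ?thesis
      proof cases
        case 1
        then have "p 1 = 3" "p 3 = 1" using a B pn by auto
        moreover have "p 2 = 2"
          using p_ge2[of 2] p_le(2)[of 2] p_ne[of 2 1] 1 \<open>p 1 = 3\<close> by force
        moreover have "p x = x" if "x \<notin> {1, 2, 3}" for x
          using permutes_not_in[OF perm, of x] 1 that atLeastAtMost_1_3 by simp
        ultimately have "p = perm_321"
          by (intro ext) (auto simp: perm_321_def)
        with 1 show ?thesis by blast
      next
        case 2
        then have p24: "p 2 = 4" "p 4 = 1" using a B pn by auto
        have p3: "p 3 = 2 \<or> p 3 = 3"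
          using p_ge2[of 3] p_le(2)[of 3] p_ne[of 3 2] 2 p24 by force
        have "p 1 \<noteq> 2"
        proof
          assume "p 1 = 2"
          with p3 p_ne[of 1 3] have "p 3 = 3" by auto
          then show False
            using no321[of 1 3 4] p24 \<open>p 1 = 2\<close> 2 by (simp add: q_eq)
        qed
        then have "p 1 = 3" using p1 by simp
        then have "p 3 = 2" using p3 p_ne[of 1 3] by auto
        have "p x = x" if "x \<notin> {1, 2, 3, 4}" for x
          using permutes_not_in[OF perm, of x] 2 that atLeastAtMost_1_4 by simp
        then have "p = perm_3421"
          using p24 \<open>p 1 = 3\<close> \<open>p 3 = 2\<close> by (intro ext) (auto simp: perm_3421_def)
        with 2 show ?thesis by blast
      next
        case 3
        from p1 have False
        proof
          assume p1: "p 1 = 2"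
          have gt: "2 < q i" if "1 \<le> i" "i < n" "i \<noteq> a" for i
            using q_pos[of i] q_ne[of i n] q_ne[of i a] qn qa p1 that by force
          \<comment> \<open>Otherwise \<open>i\<close>, \<open>n - 1\<close>, \<open>n\<close> would form a 321 in \<open>q\<close>, because \<open>q n = 2\<close>.\<close>
          have less: "q i < q (n - 1)" if "1 \<le> i" "i \<le> n - 3" for i
            using no321[of i "n - 1" n] gt[of "n - 1"] q_ne[of i "n - 1"] qn p1 that 3 B by force
          have sq: "q i = i + 2" if "1 \<le> i" "i \<le> n - 3" for i
          proof (rule strict_mono_on_interval_eq_add[OF _ _ _ that])
            fix i assume i: "1 \<le> i" "i \<le> n - 3"
            show "2 < q i" using gt[of i] i B 3 by simp
            show "q i \<le> n - 3 + 2" using less[OF i] q_le[of "n - 1"] 3 by linarith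
          qed (use incr B in auto)
          \<comment> \<open>The chain reaches position \<open>n - 2 = a\<close>, where the value should be \<open>n\<close>.\<close>
          have "p (n - 2) = n - 2 + 1"
            by (rule successor_chain[of p "n - 3"]) (use sq p1 3 in \<open>auto simp: q_eq\<close>)
          then show False using a B by simp
        next
          assume p1: "p 1 = 3"
          obtain j where j: "1 \<le> j" "j \<le> n" "q j = 2" using q_onto[of 2] 3 by auto
          have p2: "p 2 = 2 \<or> p 2 = 4"
            using p_ge2[of 2] p_le(1)[of 2] p_ne[of 2 1] p1 3 by force
          \<comment> \<open>The value 2 of \<open>q\<close> occurs either between \<open>a\<close> and \<open>n\<close> or at the start of the
            increasing part; both possibilities contradict injectivity.\<close>
          have "j = n - 1 \<or> j < a"
            using j qn qa p1 B by (cases "j = n"; cases "j = a") auto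
          then show False
          proof
            assume "j < a"
            then have q1: "q 1 = 2"
              using incr[of 1 j] j q_pos[of 1] q_ne[of 1 a] qa by (cases "j = 1") auto
            then have "p 3 = 2" using p1 by (simp add: q_eq)
            then have "p 2 = 4" using p2 p_ne[of 2 3] by auto
            \<comment> \<open>As \<open>q n = 3 < q (n - 1)\<close>, avoiding 321 makes \<open>q (n - 1)\<close> larger than the increasing
              part, so that the value 4 occurs within that part, at position 2.\<close>
            have "3 < q (n - 1)"
              using q_pos[of "n - 1"] q_ne[of "n - 1" a] q_ne[of "n - 1" 1] q_ne[of "n - 1" n]
                q1 qa qn p1 B 3 by force
            then have less: "q i < q (n - 1)" if "1 \<le> i" "i < a" for i
              using no321[of i "n - 1" n] q_ne[of i "n - 1"] qn p1 that 3 B by force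
            obtain l where l: "1 \<le> l" "l \<le> n" "q l = 4" using q_onto[of 4] 3 by auto
            have "q 2 < q (n - 1)" using less[of 2] B 3 by simp
            moreover have "3 < q 2"
              using incr[of 1 2] q1 q_ne[of 2 n] qn p1 3 B by force
            ultimately have "l \<noteq> n - 1" using l by auto
            then have "l < a"
              using l qn qa p1 B by (cases "l = n"; cases "l = a") auto
            then have "q 2 = 4"
              using incr[of 2 l] l q1 \<open>3 < q 2\<close> by (cases "l = 1"; cases "l = 2") auto
            then show False using \<open>p 2 = 4\<close> p_ne[of 2 4] by (simp add: q_eq)
          next
            assume "j = n - 1"
            then have qn1: "q (n - 1) = 2" using j by simp
            \<comment> \<open>Now 1, 2 and 3 are all taken at \<open>a\<close>, \<open>n - 1\<close> and \<open>n\<close>, so the increasing part of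
              \<open>q\<close> is the translation by 3.\<close>
            have gt: "3 < q i" if "1 \<le> i" "i < a" for i
              using q_pos[of i] q_ne[of i n] q_ne[of i a] q_ne[of i "n - 1"] qn qa qn1 p1 that B 3
              by force
            have "q 1 = 1 + 3"
              by (rule strict_mono_on_interval_eq_add[of "n - 3" q 3 1])
                (use incr gt q_le B 3 in auto)
            then have "p 3 = 4" using p1 by (simp add: q_eq)
            then have "p 2 = 2" using p2 p_ne[of 2 3] by auto
            then have "q 2 = 2" by (simp add: q_eq)
            moreover have "2 \<noteq> n - 1" using 3 by linarith
            ultimately show False using qn1 q_ne[of 2 "n - 1"] by simp
          qed
        qed
        then show ?thesis ..
      qed
    qed
  qed
qed

lemma good_blocks_eq:
  assumes "1 \<le> n"
  shows "good_blocks n = {shift_cycle n} \<union> (if n = 3 then {perm_321} else {})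
    \<union> (if n = 4 then {perm_3421} else {})"
proof (intro subset_antisym subsetI)
  fix p assume "p \<in> good_blocks n"
  then show "p \<in> {shift_cycle n} \<union> (if n = 3 then {perm_321} else {})
    \<union> (if n = 4 then {perm_3421} else {})"
    using good_block_cases[of p n] by auto
qed (use shift_cycle_good_block[OF assms] perm_321_good_block perm_3421_good_block
    in \<open>auto split: if_splits\<close>)

lemma card_good_blocks:
  "card (good_blocks n) = (if n = 0 then 0 else if n = 3 \<or> n = 4 then 2 else 1)"
proof (cases "n = 0")
  case True
  then show ?thesis by (simp add: good_blocks_def)
next
  case False
  have "shift_cycle 3 1 \<noteq> perm_321 1" "shift_cycle 4 1 \<noteq> perm_3421 1"
    by (simp_all add: shift_cycle_def perm_321_def perm_3421_def)
  then have "shift_cycle 3 \<noteq> perm_321" "shift_cycle 4 \<noteq> perm_3421" by auto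
  with False show ?thesis by (auto simp: good_blocks_eq)
qed

section \<open>The generating function\<close>

lemma fps_divide_eqI:
  fixes A C D :: "'a::field fps"
  assumes "fps_nth D 0 \<noteq> 0" "A * D = C"
  shows "A = C / D"
  using assms by (metis fps_zero_nth nonzero_mult_div_cancel_right)

lemma fps_good_perms_eq:
  defines "A \<equiv> Abs_fps (\<lambda>n. of_nat (card (good_perms n)) :: rat)"
    and "I \<equiv> Abs_fps (\<lambda>n. of_nat (card (good_blocks n)) :: rat)"
  shows "A = 1 + I * A"
proof (rule fps_ext)
  fix n
  show "fps_nth A n = fps_nth (1 + I * A) n"
  proof (cases "n = 0")
    case True
    have "good_perms 0 = {id}"
      unfolding good_perms_def contains_312_iff contains_321_iff contains_4321_iff by auto
    with True show ?thesis
      by (simp add: A_def I_def fps_mult_nth good_blocks_def)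
  next
    case False
    have "fps_nth (I * A) n =
        (\<Sum>k=0..n. of_nat (card (good_blocks k) * card (good_perms (n - k))))"
      by (simp add: fps_mult_nth A_def I_def)
    also have "\<dots> = (\<Sum>k=1..n. of_nat (card (good_blocks k) * card (good_perms (n - k))))"
      by (simp add: sum.atLeast_Suc_atMost[of 0] card_good_blocks)
    also have "\<dots> = fps_nth A n"
      using card_good_perms_rec[of n] False by (simp add: A_def)
    finally show ?thesis using False by simp
  qed
qed

lemma fps_good_blocks_eq:
  "Abs_fps (\<lambda>n. of_nat (card (good_blocks n)) :: rat) * (1 - fps_X)
     = fps_X + fps_X ^ 3 - fps_X ^ 5"
proof -
  define J :: "rat fps" where "J = Abs_fps (\<lambda>n. if n = 0 then 0 else 1)"
  have "J * (1 - fps_X) = fps_X"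
    by (rule fps_ext) (auto simp: J_def right_diff_distrib)
  moreover have "Abs_fps (\<lambda>n. of_nat (card (good_blocks n)) :: rat) = J + fps_X ^ 3 + fps_X ^ 4"
    by (rule fps_ext) (auto simp: J_def card_good_blocks)
  ultimately show ?thesis
    by (simp add: algebra_simps eval_nat_numeral)
qed

theorem theorem4p6:
  shows "Abs_fps (\<lambda>n. of_nat (avoid_count n {[3,1,2], [4,3,2,1]} [3,2,1]) :: rat)
       = (1 - fps_X) / (1 - 2 * fps_X - fps_X ^ 3 + fps_X ^ 5)"
proof -
  define A where "A = Abs_fps (\<lambda>n. of_nat (card (good_perms n)) :: rat)"
  define I where "I = Abs_fps (\<lambda>n. of_nat (card (good_blocks n)) :: rat)"
  have A: "A = 1 + I * A"
    unfolding A_def I_def by (rule fps_good_perms_eq)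
  have I: "I * (1 - fps_X) = fps_X + fps_X ^ 3 - fps_X ^ 5"
    unfolding I_def by (rule fps_good_blocks_eq)
  have "A * (1 - 2 * fps_X - fps_X ^ 3 + fps_X ^ 5) = A * ((1 - fps_X) - I * (1 - fps_X))"
    unfolding I by (simp add: algebra_simps)
  also have "\<dots> = (A - I * A) * (1 - fps_X)"
    by (simp add: algebra_simps)
  also have "A - I * A = 1"
    using A by (metis add_diff_cancel_right')
  finally have "A * (1 - 2 * fps_X - fps_X ^ 3 + fps_X ^ 5) = 1 - fps_X"
    by simp
  then have "A = (1 - fps_X) / (1 - 2 * fps_X - fps_X ^ 3 + fps_X ^ 5)"
    by (intro fps_divide_eqI) simp_all
  then show ?thesis
    unfolding A_def avoid_count_eq_card .
qed

end
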